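(* For any $b,h\in[0,1]$, $K\ge 0$, $L\in\mathbb{Z}_{\ge 0}$, $T\in\mathbb{Z}_{>0}$, and $H>0$, the class $\mathcal{L}(\Pi_S)=\{\ell(S,\cdot):S\in[0,H]\}$ of loss functions induced by stationary base-stock policies with levels in $[0,H]$ satisfies $\mathrm{P\text{-}dim}(\mathcal{L}(\Pi_S))\le 2$.
   Context: Inventory model (backlogged demand, lead time $L$). There are $T+L$ periods; a demand sequence is $\mathbf{d}=(d^1,\dots,d^{T+L})\in[0,U]^{T+L}$, where $U>0$ is a fixed constant. Let $x^t$ be the inventory level at the beginning of period $t$ and $q^t\ge 0$ the quantity ordered in period $t$ (arriving in period $t+L$), with $q^t=0$ for $t\le 0$. The inventory position before ordering is $I^t=x^t+\sum_{t'=t-L}^{t-1}q^{t'}$. After replenishment the inventory level is $y^t=x^t+q^{t-L}$, and $x^{t+1}=y^t-d^t$. The initial level $x^1\le 0$ is a fixed constant. Let $c(x)=h\max\{x,0\}+b\max\{-x,0\}$. The loss in period $t$ of a policy $\pi$ is $\ell^t(\pi,\mathbf{d})=c(y^t-d^t)+K\cdot\mathbb{I}\{q^{t-L}>0\}$, and the loss is $\ell(\pi,\mathbf{d})=\frac1T\sum_{t=L+1}^{T+L}\ell^t(\pi,\mathbf{d})$. Stationary base-stock policies: $\Pi_S=\{S:S\in[0,H]\}$; the policy $S$ orders $q^t=\max\{S-I^t,0\}$ in every period $t\ge1$. Pseudo-dimension: a dataset $(\mathbf{d}_i)_{i=1}^m$ in $[0,U]^{T+L}$ is shattered by a class $\{f(\pi,\cdot):\pi\in\Pi\}$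 of real-valued functions if there exist $\tau_1,\dots,\tau_m\in\mathbb{R}$ such that for every $A\subseteq\{1,\dots,m\}$ there is $\pi\in\Pi$ with $f(\pi,\mathbf{d}_i)>\tau_i$ for all $i\in A$ and $f(\pi,\mathbf{d}_i)\le\tau_i$ for all $i\notin A$. The Pseudo-dimension $\mathrm{P\text{-}dim}$ is the maximum size of a dataset that can be shattered. *)

theory Defs
  imports Complex_Main "HOL-Library.FuncSet" "HOL-Library.Extended_Nat"
begin

definition pseudo_shattered :: "'x set \<Rightarrow> ('x \<Rightarrow> real) set \<Rightarrow> nat \<Rightarrow> (nat \<Rightarrow> 'x) \<Rightarrow> bool" where
  "pseudo_shattered X F m D \<longleftrightarrow>
     D \<in> {1..m} \<rightarrow> X \<and>
     (\<exists>\<tau> :: nat \<Rightarrow> real. \<forall>A \<subseteq> {1..m}. \<exists>f \<in> F.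
        (\<forall>i \<in> A. f (D i) > \<tau> i) \<and> (\<forall>i \<in> {1..m} - A. f (D i) \<le> \<tau> i))"

text \<open>The supremum in \<^typ>\<open>enat\<close> is the maximum when the sizes are bounded, and \<open>\<infinity>\<close> otherwise.\<close>

definition pseudo_dim :: "'x set \<Rightarrow> ('x \<Rightarrow> real) set \<Rightarrow> enat" where
  "pseudo_dim X F = Sup {enat m | m. \<exists>D. pseudo_shattered X F m D}"

text \<open>
  Demand sequences are indexed by the periods \<open>1, \<dots>, T + L\<close>. A policy maps the period and the
  inventory position before ordering to the quantity ordered.
\<close>

definition demand_seqs :: "real \<Rightarrow> nat \<Rightarrow> nat \<Rightarrow> (nat \<Rightarrow> real) set" where
  "demand_seqs U T L = {1..T + L} \<rightarrow>\<^sub>E {0..U}"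

type_synonym policy = "nat \<Rightarrow> real \<Rightarrow> real"

text \<open>
  Below, \<open>L\<close> is the lead time, \<open>x1\<close> the inventory level at the beginning of period 1, \<open>p\<close> the
  policy and \<open>d\<close> the demand sequence. Periods are natural numbers and nothing is ordered in
  period 0, so the truncated difference \<open>t - L\<close> yields the convention that orders of periods
  \<open>\<le> 0\<close> vanish. The inventory level at \<open>t = 0\<close> is a dummy value.
\<close>

function inv_level :: "nat \<Rightarrow> real \<Rightarrow> policy \<Rightarrow> (nat \<Rightarrow> real) \<Rightarrow> nat \<Rightarrow> real"
  and inv_position :: "nat \<Rightarrow> real \<Rightarrow> policy \<Rightarrow> (nat \<Rightarrow> real) \<Rightarrow> nat \<Rightarrow> real"
  and order_qty :: "nat \<Rightarrow> real \<Rightarrow> policy \<Rightarrow> (nat \<Rightarrow> real) \<Rightarrow> nat \<Rightarrow> real"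
  and replenished_level :: "nat \<Rightarrow> real \<Rightarrow> policy \<Rightarrow> (nat \<Rightarrow> real) \<Rightarrow> nat \<Rightarrow> real"
where
  "inv_level L x1 p d t =
     (if t \<le> 1 then x1 else replenished_level L x1 p d (t - 1) - d (t - 1))"
| "inv_position L x1 p d t =
     inv_level L x1 p d t + (\<Sum>t' = t - L..<t. order_qty L x1 p d t')"
| "order_qty L x1 p d t = (if t = 0 then 0 else p t (inv_position L x1 p d t))"
| "replenished_level L x1 p d t = inv_level L x1 p d t + order_qty L x1 p d (t - L)"
  by pat_completeness auto
termination
  by (relation "measure (\<lambda>a. case a of
        Inl (Inl (_, _, _, _, t)) \<Rightarrow> 4 * t
      | Inl (Inr (_, _, _, _, t)) \<Rightarrow> 4 * t + 1
      | Inr (Inl (_, _, _, _, t)) \<Rightarrow> 4 * t + 2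
      | Inr (Inr (_, _, _, _, t)) \<Rightarrow> 4 * t + 3)") auto

declare inv_level.simps [simp del] inv_position.simps [simp del]
  order_qty.simps [simp del] replenished_level.simps [simp del]

definition holding_backlog_cost :: "real \<Rightarrow> real \<Rightarrow> real \<Rightarrow> real" where
  "holding_backlog_cost h b x = h * max x 0 + b * max (- x) 0"

definition period_loss ::
  "real \<Rightarrow> real \<Rightarrow> real \<Rightarrow> nat \<Rightarrow> real \<Rightarrow> policy \<Rightarrow> (nat \<Rightarrow> real) \<Rightarrow> nat \<Rightarrow> real" where
  "period_loss h b K L x1 p d t =
     holding_backlog_cost h b (replenished_level L x1 p d t - d t)
     + K * of_bool (order_qty L x1 p d (t - L) > 0)"

definition loss ::
  "real \<Rightarrow> real \<Rightarrow> real \<Rightarrow> nat \<Rightarrow> nat \<Rightarrow> real \<Rightarrow> policy \<Rightarrow> (nat \<Rightarrow> real) \<Rightarrow> real" where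
  "loss h b K T L x1 p d = 1 / real T * (\<Sum>t = L + 1..T + L. period_loss h b K L x1 p d t)"

definition base_stock :: "real \<Rightarrow> policy" where
  "base_stock S = (\<lambda>t I. max (S - I) 0)"

definition base_stock_losses ::
  "real \<Rightarrow> real \<Rightarrow> real \<Rightarrow> nat \<Rightarrow> nat \<Rightarrow> real \<Rightarrow> real \<Rightarrow> ((nat \<Rightarrow> real) \<Rightarrow> real) set" where
  "base_stock_losses h b K T L x1 H = {loss h b K T L x1 (base_stock S) | S. S \<in> {0..H}}"

end

theory Submission
  imports Defs "HOL-Analysis.Line_Segment"
begin

text \<open>
  Since \<open>x1 \<le> 0 \<le> S\<close>, the policy raises the inventory position to \<open>S\<close> in every period, so every order
  after the first equals the preceding demand. Hence on \<open>S > 0\<close> the loss is convex in \<open>S\<close>, and its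
  sublevel sets are intervals. Traversing finitely many points cyclically, one enters and leaves
  each of \<open>m\<close> intervals at most once, so the intervals cut out at most \<open>2 m\<close> patterns. The level
  \<open>S = 0\<close> may contribute one more, because for \<open>x1 = 0\<close> the fixed cost of the first order vanishes
  there. Shattering thus forces \<open>2 ^ m \<le> 2 m + 1\<close>.
\<close>

section \<open>Counting points separated by intervals\<close>

text \<open>Each point differs from its cyclic successor in some interval \<open>J i\<close>.
  Sending the point to this \<open>i\<close>, together with the direction of the crossing, is
  injective, and there are only \<open>2 * card I\<close> such pairs.\<close>

lemma card_le_if_separated_by_intervals:
  fixes X :: "'a :: linorder set" and J :: "'i \<Rightarrow> 'a set"
  assumes X: "finite X" "card X \<ge> 2" and I: "finite I"
    and conv: "\<And>i x y z. \<lbrakk>i \<in> I; x \<in> J i; z \<in> J i; y \<in> X; x \<le> y; y \<le> z\<rbrakk> \<Longrightarrow> y \<in> J i"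
    and sep: "\<And>x y. \<lbrakk>x \<in> X; y \<in> X; x \<noteq> y\<rbrakk> \<Longrightarrow> \<exists>i\<in>I. (x \<in> J i) \<noteq> (y \<in> J i)"
  shows "card X \<le> 2 * card I"
proof -
  have ne: "X \<noteq> {}" using X by auto
  \<comment> \<open>the cyclic successor in \<open>X\<close>\<close>
  define s where "s x = (if x = Max X then Min X else Min {y \<in> X. x < y})" for x
  have gt_ne: "{y \<in> X. x < y} \<noteq> {}" if "x \<in> X" "x \<noteq> Max X" for x
  proof -
    have "x < Max X" using that Max_ge[OF X(1)] by (metis order_less_le)
    then show ?thesis using Max_in[OF X(1) ne] by blast
  qed
  have s_gt: "s x \<in> X" "x < s x" if "x \<in> X" "x \<noteq> Max X" for x
  proof -
    have "finite {y \<in> X. x < y}" using X(1) by simp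
    from Min_in[OF this gt_ne[OF that]] show "s x \<in> X" "x < s x" using that by (simp_all add: s_def)
  qed
  have s_le: "s x \<le> y" if "x \<in> X" "y \<in> X" "x < y" for x y
  proof -
    have "x \<noteq> Max X" using that Max_ge[OF X(1), of y] by force
    then show ?thesis using that X(1) by (auto simp: s_def intro!: Min_le)
  qed
  have s_Max: "s (Max X) = Min X" by (simp add: s_def)
  have s_in: "s x \<in> X" if "x \<in> X" for x
    using that s_gt(1) s_Max X(1) ne by (cases "x = Max X") auto
  \<comment> \<open>Having two points makes even the step from \<open>Max X\<close> back to
    \<open>Min X\<close> move, so \<open>s\<close> has no fixed point.\<close>
  have Min_less_Max: "Min X < Max X"
  proof (rule ccontr)
    assume "\<not> Min X < Max X"
    then have "X \<subseteq> {Min X}"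
      using Min_le[OF X(1)] Max_ge[OF X(1)] by (fastforce intro: antisym)
    then have "card X \<le> card {Min X}" by (intro card_mono) auto
    then show False using X(2) by simp
  qed
  have s_neq: "s x \<noteq> x" if "x \<in> X" for x
    using that s_gt(2) s_Max Min_less_Max by (cases "x = Max X") force+
  have s_less: "s x \<noteq> s y" if "x \<in> X" "y \<in> X" "x < y" for x y
  proof (cases "y = Max X")
    case True
    have "x < s x" using that True by (intro s_gt) auto
    moreover have "Min X \<le> x" using that X(1) by simp
    ultimately show ?thesis using True s_Max by auto
  next
    case False
    then show ?thesis using s_le[OF that] s_gt(2)[of y] that by auto
  qed
  have s_inj: "x = y" if "x \<in> X" "y \<in> X" "s x = s y" for x y
    using s_less that by (metis linorder_less_linear)
  \<comment> \<open>An entry lands on the least point of \<open>X\<close> in \<open>J i\<close>: a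
    point of \<open>J i\<close> at or below \<open>x\<close> would force \<open>x\<close> into
    \<open>J i\<close> by convexity.\<close>
  have enter: "s x \<le> z" if "x \<in> X" "x \<notin> J i" "s x \<in> J i" "i \<in> I" "z \<in> X" "z \<in> J i" for x z i
  proof (cases "x = Max X")
    case True
    then show ?thesis using that X(1) s_Max by simp
  next
    case False
    show ?thesis
    proof (rule ccontr)
      assume "\<not> s x \<le> z"
      then have "z \<le> x" using s_le that by (meson linorder_not_le)
      then show False using conv[of i z "s x" x] that
          less_imp_le[OF s_gt(2)[of x]] False by auto
    qed
  qed
  \<comment> \<open>Dually, an exit starts from the greatest point of \<open>X\<close> in
    \<open>J i\<close>.\<close>
  have leave: "z \<le> x" if "x \<in> X" "x \<in> J i" "s x \<notin> J i" "i \<in> I" "z \<in> X" "z \<in> J i" for x z i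
  proof (rule ccontr)
    assume "\<not> z \<le> x"
    then have "x < z" by simp
    then have "x \<noteq> Max X" using that Max_ge[OF X(1), of z] by force
    then show False
      using conv[of i x z "s x"] s_le[of x z] s_gt(1)[of x] less_imp_le[OF s_gt(2)[of x]]
        \<open>x < z\<close> that by auto
  qed
  have "\<exists>i\<in>I. (x \<in> J i) \<noteq> (s x \<in> J i)" if "x \<in> X" for x
    using sep[OF that s_in[OF that]] s_neq[OF that] by metis
  then obtain g where g: "\<And>x. x \<in> X \<Longrightarrow> g x \<in> I \<and> (x \<in> J (g x)) \<noteq> (s x \<in> J (g x))"
    by metis
  \<comment> \<open>The Boolean is true for exits and false for entries. Equal pairs thus share
    either the greatest point \<open>x\<close> or the least point \<open>s x\<close>; in the latter
    case injectivity of \<open>s\<close> concludes.\<close>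
  have "inj_on (\<lambda>x. (g x, x \<in> J (g x))) X"
  proof (rule inj_onI)
    fix x y assume xy: "x \<in> X" "y \<in> X" and eq: "(g x, x \<in> J (g x)) = (g y, y \<in> J (g y))"
    define i where "i = g x"
    have i: "i \<in> I" "(x \<in> J i) = (y \<in> J i)" "(x \<in> J i) \<noteq> (s x \<in> J i)" "(y \<in> J i) \<noteq> (s y \<in> J i)"
      using g[OF xy(1)] g[OF xy(2)] eq unfolding i_def prod.inject by (metis, metis, metis, metis)
    show "x = y"
    proof (cases "x \<in> J i")
      case True
      then have "y \<le> x" "x \<le> y" using leave xy i by blast+
      then show ?thesis by simp
    next
      case False
      then have "s x \<le> s y" "s y \<le> s x" using enter xy i s_in by blast+
      then show ?thesis using s_inj xy by (metis antisym)
    qed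
  qed
  moreover have "(\<lambda>x. (g x, x \<in> J (g x))) ` X \<subseteq> I \<times> UNIV" using g by auto
  ultimately have "card X \<le> card (I \<times> (UNIV :: bool set))"
    using I by (intro card_inj_on_le) auto
  then show ?thesis by (simp add: card_cartesian_product mult.commute)
qed

section \<open>Inventory dynamics under a base-stock policy\<close>

text \<open>The order arriving in period \<open>t\<close> moves from the pipeline sum into the
  inventory level, so the lead time cancels from the recursion.\<close>

lemma inv_position_Suc:
  assumes "t \<ge> 1"
  shows "inv_position L x1 p d (Suc t) = inv_position L x1 p d t + order_qty L x1 p d t - d t"
proof -
  let ?q = "order_qty L x1 p d"
  have q0: "?q 0 = 0" by (simp add: order_qty.simps)
  have "?q (t - L) + (\<Sum>t' = Suc t - L..<Suc t. ?q t') = (\<Sum>t' = t - L..<Suc t. ?q t')"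
  proof (cases "L \<le> t")
    case True
    then have "Suc t - L = Suc (t - L)" "t - L < Suc t" by auto
    then show ?thesis using sum.atLeast_Suc_lessThan[of "t - L" "Suc t" ?q] by metis
  next
    case False
    then show ?thesis using q0 by simp
  qed
  moreover have "inv_level L x1 p d (Suc t) = inv_level L x1 p d t + ?q (t - L) - d t"
    using assms by (simp add: inv_level.simps[of L x1 p d "Suc t"] replenished_level.simps)
  \<comment> \<open>This lets the simplifier split the last order off the window ending at
    \<open>t\<close>.\<close>
  moreover have "\<not> t < t - L" by linarith
  ultimately show ?thesis
    by (simp add: inv_position.simps)
qed

text \<open>Ordering lifts the position to exactly \<open>S\<close> and nonnegative demand can only
  lower it. Hence the truncation at 0 in \<open>base_stock\<close> never takes effect.\<close>

lemma inv_position_base_stock_le: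
  assumes "x1 \<le> S" "t \<ge> 1" "\<And>s. \<lbrakk>1 \<le> s; s < t\<rbrakk> \<Longrightarrow> d s \<ge> 0"
  shows "inv_position L x1 (base_stock S) d t \<le> S"
  using assms(2,3)
proof (induction t rule: dec_induct)
  case base
  \<comment> \<open>The window is empty if \<open>L = 0\<close> and otherwise contains only period
    0, in which nothing is ordered.\<close>
  have "(\<Sum>t' = Suc 0 - L..<Suc 0. order_qty L x1 (base_stock S) d t') = 0"
    by (cases L) (auto simp: order_qty.simps)
  then show ?case using assms(1) by (simp add: inv_position.simps inv_level.simps)
next
  case (step t)
  then show ?case
    by (simp add: inv_position_Suc order_qty.simps base_stock_def)
qed

lemma inv_position_base_stock_Suc:
  assumes "x1 \<le> S" "t \<ge> 1" "\<And>s. \<lbrakk>1 \<le> s; s < t\<rbrakk> \<Longrightarrow> d s \<ge> 0"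
  shows "inv_position L x1 (base_stock S) d (Suc t) = S - d t"
  using inv_position_base_stock_le[OF assms] assms(2)
  by (simp add: inv_position_Suc order_qty.simps base_stock_def)

lemma order_qty_base_stock_Suc:
  assumes "x1 \<le> S" "t \<ge> 1" "\<And>s. \<lbrakk>1 \<le> s; s \<le> t\<rbrakk> \<Longrightarrow> d s \<ge> 0"
  shows "order_qty L x1 (base_stock S) d (Suc t) = d t"
  using inv_position_base_stock_Suc[of x1 S t d L] assms
  by (simp add: order_qty.simps base_stock_def)

lemma order_qty_base_stock_1:
  assumes "x1 \<le> S"
  shows "order_qty L x1 (base_stock S) d 1 = S - x1"
proof -
  have "(\<Sum>t' = Suc 0 - L..<Suc 0. order_qty L x1 (base_stock S) d t') = 0"
    by (cases L) (auto simp: order_qty.simps)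
  then show ?thesis using assms
    by (simp add: order_qty.simps[of L x1 _ d "Suc 0"]
        base_stock_def inv_position.simps inv_level.simps)
qed

text \<open>The net level is the next position, \<open>S - d t\<close>, minus the pipeline, whose
  orders repeat the demands of the periods \<open>t - L\<close> to \<open>t - 1\<close>.\<close>

lemma net_level_base_stock:
  assumes "x1 \<le> S" "t \<ge> L + 1" "\<And>s. \<lbrakk>1 \<le> s; s \<le> t\<rbrakk> \<Longrightarrow> d s \<ge> 0"
  shows "replenished_level L x1 (base_stock S) d t - d t = S - (\<Sum>s = t - L..t. d s)"
proof -
  let ?q = "order_qty L x1 (base_stock S) d"
  \<comment> \<open>As \<open>t - L \<ge> 1\<close>, these orders are placed in period 2 or later,
    so each equals the preceding demand.\<close>
  have "(\<Sum>s = Suc t - L..<Suc t. ?q s) = (\<Sum>s = Suc (t - L)..<Suc t. ?q s)"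
    using assms(2) by (simp add: Suc_diff_le)
  also have "\<dots> = (\<Sum>s = t - L..<t. ?q (Suc s))"
    by (rule sum.shift_bounds_Suc_ivl)
  also have "\<dots> = (\<Sum>s = t - L..<t. d s)"
    using assms by (intro sum.cong refl order_qty_base_stock_Suc) auto
  finally have "inv_position L x1 (base_stock S) d (Suc t)
      = replenished_level L x1 (base_stock S) d t - d t + (\<Sum>s = t - L..<t. d s)"
    using assms(2) by (simp add: inv_position.simps inv_level.simps[of L x1 _ d "Suc t"])
  moreover have "inv_position L x1 (base_stock S) d (Suc t) = S - d t"
    using assms by (intro inv_position_base_stock_Suc) auto
  moreover have "(\<Sum>s = t - L..t. d s) = (\<Sum>s = t - L..<t. d s) + d t"
    by (subst sum.last_plus) (auto simp: add.commute lessThan_atLeast0)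
  ultimately show ?thesis by simp
qed

section \<open>Convexity of the loss in the base-stock level\<close>

lemma convex_on_cong_imp:
  assumes "convex_on S f" "\<And>x. x \<in> S \<Longrightarrow> g x = f x"
  shows "convex_on S g"
  unfolding convex_on_def
proof (intro conjI ballI allI impI)
  show "convex S" using assms(1) by (rule convex_on_imp_convex)
  fix x y and u v :: real
  assume *: "x \<in> S" "y \<in> S" "0 \<le> u" "0 \<le> v" "u + v = 1"
  then have "u *\<^sub>R x + v *\<^sub>R y \<in> S" using \<open>convex S\<close> by (simp add: convexD)
  then show "g (u *\<^sub>R x + v *\<^sub>R y) \<le> u * g x + v * g y"
    using * assms by (simp add: convex_on_def)
qed

lemma convex_on_sum_functions:
  assumes "convex S" "\<And>i. i \<in> A \<Longrightarrow> convex_on S (f i)"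
  shows "convex_on S (\<lambda>x. \<Sum>i\<in>A. f i x :: real)"
  using assms(2)
  by (induction A rule: infinite_finite_induct)
     (auto simp: convex_on_const assms(1) intro!: convex_on_add)

text \<open>Supplies the order convexity that the counting lemma asks of \<open>J i\<close>.\<close>

lemma convex_on_sublevel_interval:
  fixes f :: "real \<Rightarrow> real"
  assumes "convex_on S f" "x \<in> S" "z \<in> S" "f x \<le> c" "f z \<le> c" "x \<le> y" "y \<le> z"
  shows "f y \<le> c"
proof -
  have "y \<in> closed_segment x z" using assms by (simp add: closed_segment_eq_real_ivl)
  then obtain u where "y = (1 - u) *\<^sub>R x + u *\<^sub>R z" "0 \<le> u" "u \<le> 1"
    by (auto simp: closed_segment_def)
  then have "f y \<le> max (f x) (f z)" using convex_lower[OF assms(1-3), of "1 - u" u] by simp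
  then show ?thesis using assms by simp
qed

text \<open>Each maximum is the larger of two affine functions of \<open>S\<close>, and the weights
  \<open>h\<close> and \<open>b\<close> are nonnegative.\<close>

lemma convex_on_holding_backlog_cost:
  assumes "h \<ge> 0" "b \<ge> 0"
  shows "convex_on UNIV (\<lambda>S. holding_backlog_cost h b (S - a))"
  unfolding holding_backlog_cost_def
proof (intro convex_on_add convex_on_cmul assms)
  show "convex_on UNIV (\<lambda>S. max (S - a) 0)"
  proof (rule convex_onI)
    fix u x y :: real assume u: "0 < u" "u < 1"
    have "(1 - u) * (x - a) + u * (y - a) \<le> (1 - u) * max (x - a) 0 + u * max (y - a) 0"
      "0 \<le> (1 - u) * max (x - a) 0 + u * max (y - a) 0"
      using u by (auto intro!: add_mono mult_left_mono)
    then show "max ((1 - u) *\<^sub>R x + u *\<^sub>R y - a) 0 \<le> (1 - u) * max (x - a) 0 + u * max (y - a) 0"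
      by (intro max.boundedI) (simp_all add: algebra_simps)
  qed simp
  show "convex_on UNIV (\<lambda>S. max (- (S - a)) 0)"
  proof (rule convex_onI)
    fix u x y :: real assume u: "0 < u" "u < 1"
    have "(1 - u) * (a - x) + u * (a - y) \<le> (1 - u) * max (a - x) 0 + u * max (a - y) 0"
      "0 \<le> (1 - u) * max (a - x) 0 + u * max (a - y) 0"
      using u by (auto intro!: add_mono mult_left_mono)
    then show "max (- ((1 - u) *\<^sub>R x + u *\<^sub>R y - a)) 0
        \<le> (1 - u) * max (- (x - a)) 0 + u * max (- (y - a)) 0"
      by (intro max.boundedI) (simp_all add: algebra_simps)
  qed simp
qed

text \<open>
  The level \<open>S = x1\<close> must be excluded: there the order of period 1 vanishes, and its fixed cost
  makes the loss jump.
\<close>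

lemma convex_on_loss_base_stock:
  assumes hb: "h \<ge> 0" "b \<ge> 0" and d: "\<And>s. s \<in> {1..T + L} \<Longrightarrow> d s \<ge> 0"
  shows "convex_on {x1<..} (\<lambda>S. loss h b K T L x1 (base_stock S) d)"
proof -
  \<comment> \<open>Closed form of the period loss for \<open>S > x1\<close>. The first order
    \<open>S - x1\<close> is positive and later ones are past demands, so the fixed cost is constant
    in \<open>S\<close>. The disjunct \<open>t = L + 1\<close> is that first order and settles the
    case where \<open>d\<close> would be read at index 0.\<close>
  define g where "g t S = holding_backlog_cost h b (S - (\<Sum>s = t - L..t. d s))
      + K * of_bool (t = L + 1 \<or> d (t - L - 1) > 0)" for t S
  have eq: "loss h b K T L x1 (base_stock S) d = 1 / real T * (\<Sum>t = L + 1..T + L. g t S)"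
    if S: "S \<in> {x1<..}" for S
  proof -
    have "period_loss h b K L x1 (base_stock S) d t = g t S" if t: "t \<in> {L + 1..T + L}" for t
    proof -
      have "order_qty L x1 (base_stock S) d (t - L) > 0 \<longleftrightarrow> t = L + 1 \<or> d (t - L - 1) > 0"
      proof (cases "t = L + 1")
        case True
        then show ?thesis using S order_qty_base_stock_1[of x1 S L d] by simp
      next
        case False
        then have *: "t - L = Suc (t - L - 1)" "t - L - 1 \<ge> 1" using t by auto
        have "order_qty L x1 (base_stock S) d (Suc (t - L - 1)) = d (t - L - 1)"
          using S * t d by (intro order_qty_base_stock_Suc) auto
        then show ?thesis using * False by simp
      qed
      moreover have "replenished_level L x1 (base_stock S) d t - d t = S - (\<Sum>s = t - L..t. d s)"
        using S t d by (intro net_level_base_stock) auto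
      ultimately show ?thesis by (simp add: period_loss_def g_def)
    qed
    then show ?thesis by (simp add: loss_def)
  qed
  have "convex_on {x1<..} (g t)" for t
    unfolding g_def
    by (intro convex_on_add convex_on_subset[OF convex_on_holding_backlog_cost[OF hb]])
       (auto simp: convex_on_const)
  then have "convex_on {x1<..} (\<lambda>S. 1 / real T * (\<Sum>t = L + 1..T + L. g t S))"
    by (intro convex_on_cmul convex_on_sum_functions) auto
  then show ?thesis by (rule convex_on_cong_imp) (simp add: eq)
qed

section \<open>The bound on the pseudo-dimension\<close>

theorem theorem1:
  fixes b h K H U x1 :: real and L T :: nat
  assumes "b \<in> {0..1}" and "h \<in> {0..1}" and "K \<ge> 0" and "T > 0" and "H > 0"
    and "U > 0" and "x1 \<le> 0"
  shows "pseudo_dim (demand_seqs U T L) (base_stock_losses h b K T L x1 H) \<le> 2"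
proof -
  have "m \<le> 2" if "pseudo_shattered (demand_seqs U T L) (base_stock_losses h b K T L x1 H) m D"
    for m D
  proof (rule ccontr)
    assume "\<not> m \<le> 2"
    then have m: "m \<ge> 3" by simp
    define l where "l i S = loss h b K T L x1 (base_stock S) (D i)" for i S
    obtain \<tau> where \<tau>: "\<forall>A \<subseteq> {1..m}. \<exists>f \<in> base_stock_losses h b K T L x1 H.
        (\<forall>i \<in> A. f (D i) > \<tau> i) \<and> (\<forall>i \<in> {1..m} - A. f (D i) \<le> \<tau> i)"
      and D: "D \<in> {1..m} \<rightarrow> demand_seqs U T L"
      using \<open>pseudo_shattered _ _ m D\<close> unfolding pseudo_shattered_def by blast
    have "\<exists>S. S \<ge> 0 \<and> (\<forall>i \<in> {1..m}. l i S \<le> \<tau> i \<longleftrightarrow> i \<notin> A)" if A: "A \<in> Pow {1..m}" for A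
    proof -
      obtain f where f: "f \<in> base_stock_losses h b K T L x1 H"
        "\<forall>i \<in> A. f (D i) > \<tau> i" "\<forall>i \<in> {1..m} - A. f (D i) \<le> \<tau> i"
        using \<tau> A by blast
      then obtain S where S: "S \<ge> 0" "f = loss h b K T L x1 (base_stock S)"
        by (auto simp: base_stock_losses_def)
      have "l i S \<le> \<tau> i \<longleftrightarrow> i \<notin> A" if "i \<in> {1..m}" for i
        using f(2,3) S(2) that by (cases "i \<in> A") (auto simp: l_def not_le)
      then show ?thesis using S(1) by blast
    qed
    then obtain S where S0: "\<And>A. A \<subseteq> {1..m} \<Longrightarrow> S A \<ge> 0"
      and S: "\<And>A i. \<lbrakk>A \<subseteq> {1..m}; i \<in> {1..m}\<rbrakk> \<Longrightarrow> l i (S A) \<le> \<tau> i \<longleftrightarrow> i \<notin> A"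
      by (metis PowI)
    \<comment> \<open>Both definitions keep to positive levels, which lie above
      \<open>x1 \<le> 0\<close>, where the losses are convex.\<close>
    define J where "J i = {s \<in> {0<..}. l i s \<le> \<tau> i}" for i
    define X where "X = S ` Pow {1..m} - {0}"
    \<comment> \<open>A level determines its pattern, so the \<open>2 ^ m\<close> patterns need
      distinct levels; discarding 0 loses at most one.\<close>
    have "inj_on S (Pow {1..m})"
    proof (rule inj_onI)
      fix A B assume AB: "A \<in> Pow {1..m}" "B \<in> Pow {1..m}" "S A = S B"
      then have "i \<in> A \<longleftrightarrow> i \<in> B" if "i \<in> {1..m}" for i
        using S[of A i] S[of B i] that by auto
      then show "A = B" using AB by blast
    qed
    then have "card (S ` Pow {1..m}) = 2 ^ m" by (simp add: card_image card_Pow)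
    then have card_X: "2 ^ m \<le> card X + 1"
      using card_Diff1_le[of "S ` Pow {1..m}" 0] unfolding X_def
      by (simp add: card_Diff_singleton_if)
    \<comment> \<open>Contradicts \<open>2 ^ m \<le> card X + 1 \<le> 2 * m + 1\<close>. The
      inequality is an equality at 3 and fails at 2, which is why the bound is 2.\<close>
    have pow: "2 * k + 2 \<le> 2 ^ k" if "k \<ge> 3" for k :: nat
      using that by (induction k rule: dec_induct) auto
    have "card X \<le> 2 * card {1..m}"
    proof (rule card_le_if_separated_by_intervals[where J = J])
      show "finite X" by (simp add: X_def)
      show "2 \<le> card X" using card_X pow[OF m] m by simp
    next
      fix i x y z assume *: "i \<in> {1..m}" "x \<in> J i" "z \<in> J i" "x \<le> y" "y \<le> z"
      have "D i \<in> demand_seqs U T L" using D * by auto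
      then have "convex_on {x1<..} (l i)"
        unfolding l_def using assms
        by (intro convex_on_loss_base_stock) (auto simp: demand_seqs_def PiE_iff)
      then have "convex_on {0<..} (l i)"
        using assms by (rule_tac convex_on_subset) auto
      then show "y \<in> J i"
        using * convex_on_sublevel_interval[of "{0<..}" "l i" x z "\<tau> i" y] by (auto simp: J_def)
    next
      fix x y assume "x \<in> X" "y \<in> X" and neq: "x \<noteq> y"
      then obtain A B where AB: "A \<subseteq> {1..m}" "B \<subseteq> {1..m}" "x = S A" "y = S B"
        and pos: "x > 0" "y > 0"
        using S0 unfolding X_def by (auto simp: order_less_le)
      then have "A \<noteq> B" using neq by blast
      \<comment> \<open>An index on which the two patterns differ gives a sublevel set containing
        exactly one of the two levels.\<close>
      then obtain i where "i \<in> {1..m}" "(i \<in> A) \<noteq> (i \<in> B)" using AB(1,2) by blast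
      then show "\<exists>i\<in>{1..m}. (x \<in> J i) \<noteq> (y \<in> J i)"
        using S[of A i] S[of B i] AB pos by (auto simp: J_def)
    qed simp
    then show False using card_X pow[OF m] by simp
  qed
  then have "enat m \<le> 2"
    if "\<exists>D. pseudo_shattered (demand_seqs U T L) (base_stock_losses h b K T L x1 H) m D" for m
    using that by (auto simp: numeral_eq_enat)
  then show ?thesis unfolding pseudo_dim_def by (auto intro!: Sup_least)
qed

end
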